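(* Let $E$ be a finite set, let $\mathbb{G}$ be a finite $E$-group and let $N\ge 2$. Then there exists a finite $E$-group $\hat{\mathbb{G}}$ with $\hat{\mathbb{G}}\succeq\mathbb{G}$ such that $\hat{\mathbb{G}}$ is $N$-acyclic and such that every permutation $\rho\in\mathrm{Sym}(E)$ that is a symmetry of $\mathbb{G}$ is also a symmetry of $\hat{\mathbb{G}}$.
   Context: Let $E$ be a finite set. An $E$-group is a group $\mathbb{G}$ together with an inclusion $E\subseteq\mathbb{G}$ such that $E$ generates $\mathbb{G}$ and every $e\in E$ satisfies $e\neq 1$ and $e^2=1$. For a word $w=e_1\cdots e_n\in E^*$ write $[w]_{\mathbb{G}}=e_1\cdots e_n\in\mathbb{G}$. A homomorphism of $E$-groups is a group homomorphism mapping each $e\in E$ to $e$; we write $\hat{\mathbb{G}}\succeq\mathbb{G}$ if there is a homomorphism of $E$-groups from $\hat{\mathbb{G}}$ to $\mathbb{G}$. For $\alpha\subseteq E$, $\mathbb{G}[\alpha]$ denotes the subgroup generated by $\alpha$. A coset cycle of length $n\ge 2$ in $\mathbb{G}$ is a cyclically indexed family $(g_i,\alpha_i)_{i\in\mathbb{Z}_n}$ with $g_i\in\mathbb{G}$, $\alpha_i\subseteq E$, such that for all $i\in\mathbb{Z}_n$: (connectivity) $g_{i+1}\in g_i\mathbb{G}[\alpha_i]$; (separation) $g_i\mathbb{G}[\alpha_i\cap\alpha_{i-1}]\cap g_{i+1}\mathbb{G}[\alpha_i\cap\alpha_{i+1}]=\emptyset$. For $N\ge2$, $\mathbb{G}$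 is $N$-acyclic if it admits no coset cycle of length $n$ with $2\le n\le N$. A permutation $\rho\in\mathrm{Sym}(E)$ is a symmetry of the $E$-group $\mathbb{G}$ if there is a group automorphism $\varphi$ of $\mathbb{G}$ with $\varphi(e)=\rho(e)$ for all $e\in E$. *)

theory Defs
  imports "HOL-Algebra.Algebra" "HOL-Combinatorics.Permutations"
begin

definition E_group :: "('g, 'b) monoid_scheme \<Rightarrow> 'e set \<Rightarrow> ('e \<Rightarrow> 'g) \<Rightarrow> bool" where
  "E_group G E \<iota> \<longleftrightarrow> group G \<and> \<iota> ` E \<subseteq> carrier G \<and> inj_on \<iota> E
     \<and> (\<forall>e\<in>E. \<iota> e \<noteq> \<one>\<^bsub>G\<^esub> \<and> \<iota> e \<otimes>\<^bsub>G\<^esub> \<iota> e = \<one>\<^bsub>G\<^esub>)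
     \<and> generate G (\<iota> ` E) = carrier G"

definition E_dominates ::
  "('h, 'c) monoid_scheme \<Rightarrow> ('e \<Rightarrow> 'h) \<Rightarrow> ('g, 'b) monoid_scheme \<Rightarrow> ('e \<Rightarrow> 'g) \<Rightarrow> 'e set \<Rightarrow> bool" where
  "E_dominates H \<iota>H G \<iota>G E \<longleftrightarrow> (\<exists>h \<in> hom H G. \<forall>e\<in>E. h (\<iota>H e) = \<iota>G e)"

definition sub_gen :: "('g, 'b) monoid_scheme \<Rightarrow> ('e \<Rightarrow> 'g) \<Rightarrow> 'e set \<Rightarrow> 'g set" where
  "sub_gen G \<iota> \<alpha> = generate G (\<iota> ` \<alpha>)"

definition coset_cycle ::
  "('g, 'b) monoid_scheme \<Rightarrow> 'e set \<Rightarrow> ('e \<Rightarrow> 'g) \<Rightarrow> nat \<Rightarrow> (nat \<Rightarrow> 'g) \<Rightarrow> (nat \<Rightarrow> 'e set) \<Rightarrow> bool" where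
  "coset_cycle G E \<iota> n g \<alpha> \<longleftrightarrow> 2 \<le> n \<and>
     (\<forall>i<n. g i \<in> carrier G \<and> \<alpha> i \<subseteq> E) \<and>
     (\<forall>i<n. g ((i + 1) mod n) \<in> g i <#\<^bsub>G\<^esub> sub_gen G \<iota> (\<alpha> i)) \<and>
     (\<forall>i<n. (g i <#\<^bsub>G\<^esub> sub_gen G \<iota> (\<alpha> i \<inter> \<alpha> ((i + n - 1) mod n)))
           \<inter> (g ((i + 1) mod n) <#\<^bsub>G\<^esub> sub_gen G \<iota> (\<alpha> i \<inter> \<alpha> ((i + 1) mod n))) = {})"

definition N_acyclic :: "('g, 'b) monoid_scheme \<Rightarrow> 'e set \<Rightarrow> ('e \<Rightarrow> 'g) \<Rightarrow> nat \<Rightarrow> bool" where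
  "N_acyclic G E \<iota> N \<longleftrightarrow> \<not> (\<exists>n g \<alpha>. n \<le> N \<and> coset_cycle G E \<iota> n g \<alpha>)"

definition E_symmetry :: "('g, 'b) monoid_scheme \<Rightarrow> 'e set \<Rightarrow> ('e \<Rightarrow> 'g) \<Rightarrow> ('e \<Rightarrow> 'e) \<Rightarrow> bool" where
  "E_symmetry G E \<iota> \<rho> \<longleftrightarrow> (\<exists>\<phi> \<in> iso G G. \<forall>e\<in>E. \<phi> (\<iota> e) = \<iota> (\<rho> e))"

end

(* A coset cycle in a group unfolds to a linear chain of Cayley graphs of the subgroups G[alpha_i],
   consecutive ones glued along a coset of G[alpha_i \<inter> alpha_{i+1}]; let a generator act as the
   identity on vertices without a matching edge. If G acts on all chains of length at most N of its
   own subgroups, it has no short coset cycle: the word of the cycle is trivial in G but moves the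
   start of the chain to its end. To achieve this for subgroups with ever more generators, assume
   that G acts on the chains of subgroups with at most k generators and replace G by the group G'
   of words acting on G and on the chains with at most k+1 generators. For beta of size k+1, the
   beta-components of such a chain are either cosets of G[beta] or chains of smaller subgroups (here
   G[beta] \<inter> G[gamma] = G[beta \<inter> gamma] is used), so G'[beta] = G[beta], the chains of G' with at
   most k+1 generators are those of G, and G' acts on them. The construction only depends on the
   relations of G, hence preserves symmetries. *)

theory Submission
  imports Defs
begin

section \<open>Involutive congruences on words\<close>

text \<open>Letters outside \<open>E\<close> are trivial, so that words need not be restricted to \<open>lists E\<close>.\<close>

locale involutive_cong =
  fixes E :: "'e set" and r :: "'e list \<Rightarrow> 'e list \<Rightarrow> bool"
  assumes finite_E: "finite E"
    and r_refl [simp]: "r u u"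
    and r_sym: "r u v \<Longrightarrow> r v u"
    and r_trans [trans]: "r u v \<Longrightarrow> r v w \<Longrightarrow> r u w"
    and r_append: "r u v \<Longrightarrow> r u' v' \<Longrightarrow> r (u @ u') (v @ v')"
    and r_square: "r [e, e] []"
    and r_outside: "e \<notin> E \<Longrightarrow> r [e] []"
    and finite_index: "finite (range (\<lambda>u. Collect (r u)))"
begin

lemma r_append_rev: "r (u @ rev u) []"
proof (induction u)
  case (Cons e u)
  have "r ([e] @ (u @ rev u) @ [e]) ([e] @ [] @ [e])"
    using Cons by (intro r_append) auto
  then show ?case using r_square r_trans by fastforce
qed simp

lemma r_rev_append: "r (rev u @ u) []"
  using r_append_rev[of "rev u"] by simp

lemma r_cancel_left: "r (u @ a) (u @ b) \<longleftrightarrow> r a b"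
proof
  assume "r (u @ a) (u @ b)"
  then have *: "r (rev u @ u @ a) (rev u @ u @ b)" by (simp add: r_append)
  have "r ((rev u @ u) @ c) ([] @ c)" for c
    by (intro r_append r_rev_append) simp
  then show "r a b" using * by (metis append.assoc append_Nil r_sym r_trans)
qed (simp add: r_append)

lemma r_solve_left: "r v (u @ a) \<Longrightarrow> r (v @ rev a) u"
proof -
  assume "r v (u @ a)"
  then have "r (v @ rev a) ((u @ a) @ rev a)" by (rule r_append) simp
  moreover have "r (u @ (a @ rev a)) (u @ [])" by (intro r_append r_append_rev) simp
  ultimately show ?thesis using r_trans by fastforce
qed

lemma r_filter: "r u (filter (\<lambda>e. e \<in> E) u)"
proof (induction u)
  case (Cons e u)
  then show ?case
    using r_append[of "[e]" "[e]", OF _ Cons] r_append[OF r_outside[of e] Cons] by auto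
qed simp

definition nf :: "'e list \<Rightarrow> 'e list" where
  "nf u = (SOME v. r u v)"

lemma r_nf: "r u (nf u)"
  unfolding nf_def by (rule someI[of _ u]) simp

lemma nf_eq_iff: "nf u = nf v \<longleftrightarrow> r u v"
proof
  assume "nf u = nf v"
  then show "r u v" using r_nf[of u] r_nf[of v] by (metis r_sym r_trans)
next
  assume "r u v"
  then have "r u = r v" by (intro ext) (meson r_sym r_trans)
  then show "nf u = nf v" by (simp add: nf_def)
qed

text \<open>One word is chosen for each pair of a subset of \<open>E\<close> and a class, of which
  there are finitely many. This later bounds the walks inside a block.\<close>

lemma finite_representatives:
  obtains Rep where "finite Rep" "[] \<in> Rep"
    "\<And>A a. A \<subseteq> E \<Longrightarrow> a \<in> lists A \<Longrightarrow> \<exists>b\<in>Rep. b \<in> lists A \<and> r a b"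
proof -
  define f where "f = (\<lambda>(A, C). SOME b. b \<in> lists A \<and> b \<in> (C :: 'e list set))"
  define Rep where "Rep = insert [] (f ` (Pow E \<times> range (\<lambda>u. Collect (r u))))"
  have "finite Rep" unfolding Rep_def using finite_E finite_index by auto
  moreover have "\<exists>b\<in>Rep. b \<in> lists A \<and> r a b" if "A \<subseteq> E" "a \<in> lists A" for A a
  proof -
    have "f (A, Collect (r a)) \<in> lists A \<and> f (A, Collect (r a)) \<in> Collect (r a)"
      unfolding f_def split by (rule someI[of _ a]) (use that in auto)
    moreover have "f (A, Collect (r a)) \<in> Rep" using that by (auto simp: Rep_def)
    ultimately show ?thesis by blast
  qed
  ultimately show ?thesis using that[of Rep] by (simp add: Rep_def)
qed

end

section \<open>Chain graphs\<close>

text \<open>Chains of Cayley graphs of the subgroups generated by \<open>\<alpha> i\<close>, glued along cosets of the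
  subgroups generated by \<open>\<alpha> i \<inter> \<alpha> (Suc i)\<close>. A block \<open>V i\<close> may consist of several cosets, so
  that the notion is inherited when the generators are restricted to a subset of \<open>E\<close>.\<close>

locale chain_graph =
  fixes E :: "'e set" and N k :: nat and r :: "'e list \<Rightarrow> 'e list \<Rightarrow> bool"
    and \<alpha> :: "nat \<Rightarrow> 'e set" and V :: "nat \<Rightarrow> 'v set" and act :: "'e \<Rightarrow> 'v \<Rightarrow> 'v"
  assumes alpha: "\<alpha> i \<subseteq> E" "card (\<alpha> i) \<le> k"
    and bounded: "x \<in> V i \<Longrightarrow> i < N"
    and closed: "x \<in> V i \<Longrightarrow> e \<in> \<alpha> i \<Longrightarrow> act e x \<in> V i"
    and free: "x \<in> V i \<Longrightarrow> a \<in> lists (\<alpha> i) \<Longrightarrow> b \<in> lists (\<alpha> i) \<Longrightarrow>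
      fold act a x = fold act b x \<longleftrightarrow> r a b"
    and trivial: "x \<in> V i \<Longrightarrow> (\<And>j. x \<in> V j \<Longrightarrow> e \<notin> \<alpha> j) \<Longrightarrow> act e x = x"
    and linear: "x \<in> V i \<Longrightarrow> x \<in> V j \<Longrightarrow> i \<le> Suc j"
    and overlap: "x \<in> V i \<Longrightarrow> x \<in> V j \<Longrightarrow> a \<in> lists (\<alpha> i) \<Longrightarrow> fold act a x \<in> V j \<Longrightarrow>
      \<exists>c \<in> lists (\<alpha> i \<inter> \<alpha> j). fold act c x = fold act a x"
begin

lemma fold_closed: "x \<in> V i \<Longrightarrow> a \<in> lists (\<alpha> i) \<Longrightarrow> fold act a x \<in> V i"
  by (induction a arbitrary: x) (auto intro: closed)

lemma act_in: "x \<in> V i \<Longrightarrow> \<exists>j. act e x \<in> V j"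
  using closed trivial by metis

lemma fold_in: "x \<in> V i \<Longrightarrow> \<exists>j. fold act u x \<in> V j"
  proof (induction u arbitrary: x i)
  case (Cons e u)
  then show ?case using act_in[of x i e] by auto
qed auto

text \<open>The congruence enters only through \<open>free\<close>, hence only through words over a
  single label set of at most \<open>k\<close> letters.\<close>

lemma mono_rank:
  assumes "\<And>A a b. A \<subseteq> E \<Longrightarrow> card A \<le> k \<Longrightarrow> a \<in> lists A \<Longrightarrow> b \<in> lists A \<Longrightarrow> r a b \<longleftrightarrow> r' a b"
  shows "chain_graph E N k r' \<alpha> V act"
proof
  show "fold act a x = fold act b x \<longleftrightarrow> r' a b"
    if "x \<in> V i" "a \<in> lists (\<alpha> i)" "b \<in> lists (\<alpha> i)" for x i a b
    using free[OF that] assms[OF alpha that(2,3)] by simp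
qed (use alpha bounded closed trivial linear overlap in blast)+

text \<open>Relabelling edges keeps vertices and blocks; this is why the refinement below inherits
  symmetries.\<close>

lemma permute:
  assumes \<rho>: "\<rho> permutes E" and r: "\<And>u v. r (map \<rho> u) (map \<rho> v) \<longleftrightarrow> r u v"
  shows "chain_graph E N k r (\<lambda>i. \<rho> -` \<alpha> i) V (\<lambda>e. act (\<rho> e))"
proof -
  have bij: "bij \<rho>" using \<rho> by (rule permutes_bij)
  have f: "fold (\<lambda>e. act (\<rho> e)) a = fold act (map \<rho> a)" for a
    by (simp add: fold_map o_def)
  have l: "map \<rho> a \<in> lists A \<longleftrightarrow> a \<in> lists (\<rho> -` A)" for a A by (induction a) auto
  show ?thesis
  proof
    fix i
    show "\<rho> -` \<alpha> i \<subseteq> E" using alpha(1)[of i] \<rho> permutes_in_image by fastforce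
    show "card (\<rho> -` \<alpha> i) \<le> k"
      using alpha(2)[of i] bij by (simp add: card_vimage_inj bij_is_inj bij_is_surj)
  next
    fix x i j a
    assume *: "x \<in> V i" "x \<in> V j" "a \<in> lists (\<rho> -` \<alpha> i)" "fold (\<lambda>e. act (\<rho> e)) a x \<in> V j"
    then obtain c where c: "c \<in> lists (\<alpha> i \<inter> \<alpha> j)" "fold act c x = fold act (map \<rho> a) x"
      using overlap[of x i j "map \<rho> a"] by (auto simp: f l)
    obtain d where "c = map \<rho> d" using bij 
      by (metis bij_is_surj ex_map_conv surjD)
    with c show "\<exists>c\<in>lists (\<rho> -` \<alpha> i \<inter> \<rho> -` \<alpha> j). fold (\<lambda>e. act (\<rho> e)) c x = fold (\<lambda>e. act (\<rho> e)) a x"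
      by (metis f l vimage_Int)
  next
    fix x i a b
    assume "x \<in> V i" "a \<in> lists (\<rho> -` \<alpha> i)" "b \<in> lists (\<rho> -` \<alpha> i)"
    then show "fold (\<lambda>e. act (\<rho> e)) a x = fold (\<lambda>e. act (\<rho> e)) b x \<longleftrightarrow> r a b"
      using free[of x i "map \<rho> a" "map \<rho> b"] by (simp add: f l r)
  next
    show "act (\<rho> e) x = x" if "x \<in> V i" "\<And>j. x \<in> V j \<Longrightarrow> e \<notin> \<rho> -` \<alpha> j" for x i e
      using trivial[OF that(1), of "\<rho> e"] that(2) by auto
  qed (use bounded closed linear in auto)
qed

end

text \<open>The vertex type is fixed because a definition cannot quantify over types; pairs of a
  block index and a word are what the unrolling of a coset cycle uses.\<close>

definition tame :: "'e set \<Rightarrow> nat \<Rightarrow> nat \<Rightarrow> ('e list \<Rightarrow> 'e list \<Rightarrow> bool) \<Rightarrow> bool" where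
  "tame E N k r \<longleftrightarrow> (\<forall>\<alpha> V (act :: 'e \<Rightarrow> nat \<times> 'e list \<Rightarrow> _) i x u v.
     chain_graph E N k r \<alpha> V act \<longrightarrow> x \<in> V i \<longrightarrow> r u v \<longrightarrow> fold act u x = fold act v x)"

text \<open>The kernel of the joint action of words on the quotient by \<open>r\<close> and on all
  its chain graphs of rank \<open>k\<close>: the congruence of the next group in the
  induction.\<close>

definition refine ::
  "'e set \<Rightarrow> nat \<Rightarrow> nat \<Rightarrow> ('e list \<Rightarrow> 'e list \<Rightarrow> bool) \<Rightarrow> 'e list \<Rightarrow> 'e list \<Rightarrow> bool" where
  "refine E N k r u v \<longleftrightarrow> r u v \<and> (\<forall>\<alpha> V (act :: 'e \<Rightarrow> nat \<times> 'e list \<Rightarrow> _) i x.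
     chain_graph E N k r \<alpha> V act \<longrightarrow> x \<in> V i \<longrightarrow> fold act u x = fold act v x)"

text \<open>Base of the induction: all label sets are empty, so every letter fixes every
  vertex.\<close>

lemma (in involutive_cong) tame_0: "tame E N 0 r"
  unfolding tame_def
proof (intro allI impI)
  fix \<alpha> V i u v and act :: "'e \<Rightarrow> nat \<times> 'e list \<Rightarrow> _" and x
  assume "chain_graph E N 0 r \<alpha> V act" and x: "x \<in> V i"
  then interpret chain_graph E N 0 r \<alpha> V act by simp
  have "\<alpha> j = {}" for j using alpha[of j] finite_E finite_subset by fastforce
  then have "act e x = x" for e using trivial[OF x] by simp
  then have "fold act w x = x" for w by (induction w) auto
  then show "fold act u x = fold act v x" by simp
qed

section \<open>Tame congruences have no short coset cycles\<close>

text \<open>The cycle is cut open before block 0 and unrolled into a chain graph. Its word is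
  trivial under \<open>r\<close>, so by tameness the walk from block 0 to block \<open>n - 1\<close>
  closes up, which forces two blocks and a start in their overlap. Separation is assumed at inner
  blocks only, so the case \<open>n = 2\<close> stays possible and yields the intersection
  property.\<close>

lemma (in involutive_cong) tame_no_coset_chain:
  fixes g w :: "nat \<Rightarrow> 'e list" and \<alpha> :: "nat \<Rightarrow> 'e set"
  assumes tame: "tame E N k r" and n: "2 \<le> n" "n \<le> N"
    and alpha: "\<And>i. i < n \<Longrightarrow> \<alpha> i \<subseteq> E" "\<And>i. i < n \<Longrightarrow> card (\<alpha> i) \<le> k"
    and w: "\<And>i. i < n \<Longrightarrow> w i \<in> lists (\<alpha> i)"
    and g: "\<And>i. i < n \<Longrightarrow> r (g (Suc i)) (g i @ w i)"
    and cyclic: "r (g n) (g 0)"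
    and separated: "\<And>i a b. Suc (Suc i) < n \<Longrightarrow> a \<in> lists (\<alpha> i \<inter> \<alpha> (Suc i)) \<Longrightarrow>
      b \<in> lists (\<alpha> (Suc i) \<inter> \<alpha> (Suc (Suc i))) \<Longrightarrow> \<not> r (g (Suc i) @ a) (g (Suc (Suc i)) @ b)"
  shows "n = 2 \<and> (\<exists>d\<in>lists (\<alpha> 0 \<inter> \<alpha> 1). r (g 0) (g 1 @ d))"
proof -
  \<comment> \<open>\<open>C i\<close> is the coset forming block \<open>i\<close>, and
    \<open>Ov i\<close> the coset glueing it to block \<open>i - 1\<close>; \<open>Ov 0\<close> is
    empty, as the cut is there. Labels from \<open>n\<close> on are empty because
    \<open>chain_graph\<close> is indexed by all naturals.\<close>
  define A where "A i = (if i < n then \<alpha> i else {})" for i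
  define C where "C i = {u. i < n \<and> (\<exists>a\<in>lists (A i). r u (g i @ a))}" for i
  define Ov where "Ov i = {u. 0 < i \<and> i < n \<and> (\<exists>a\<in>lists (A (i - 1) \<inter> A i). r u (g i @ a))}" for i
  text \<open>A vertex lying in two consecutive blocks is represented in the lower one.\<close>
  define nu where "nu i u = (if u \<in> Ov i then i - 1 else i, nf u)" for i u
  define V where "V i = nu i ` C i" for i
  \<comment> \<open>A vertex with tag \<open>i\<close> lies in block \<open>i\<close> and, if its
    word is in \<open>Ov (Suc i)\<close>, also in block \<open>Suc i\<close>; only letters of these
    blocks move it.\<close>
  define act where "act e = (\<lambda>(i, u). if e \<in> A i then nu i (u @ [e])
    else if u \<in> Ov (Suc i) \<and> e \<in> A (Suc i) then nu (Suc i) (u @ [e]) else (i, u))" for e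
  have O_cong: "u \<in> Ov i \<longleftrightarrow> v \<in> Ov i" if "r u v" for u v i
    using that unfolding Ov_def by (blast intro: r_trans r_sym)
  have O_E: "\<exists>b\<in>lists (A i \<inter> A (Suc i)). r u (g (Suc i) @ b)" "Suc i < n" if "u \<in> Ov (Suc i)" for u i
    using that unfolding Ov_def by auto
  have C_E: "\<exists>b\<in>lists (A i). r u (g i @ b)" "i < n" if "u \<in> C i" for u i
    using that unfolding C_def by auto
  have O_app: "u @ a \<in> Ov (Suc i)" if u: "u \<in> Ov (Suc i)" and "a \<in> lists (A i \<inter> A (Suc i))" for u a i
  proof -
    obtain b where b: "b \<in> lists (A i \<inter> A (Suc i))" "r u (g (Suc i) @ b)" and i: "Suc i < n"
      using O_E[OF u] by blast
    have "r (u @ a) (g (Suc i) @ (b @ a))" using r_append[OF b(2), of a a] by simp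
    with b that i show ?thesis unfolding Ov_def
      by (auto intro!: bexI[of _ "b @ a"])
  qed
  have C_app: "u @ a \<in> C i" if u: "u \<in> C i" and "a \<in> lists (A i)" for u a i
  proof -
    obtain b where b: "b \<in> lists (A i)" "r u (g i @ b)" and i: "i < n"
      using C_E[OF u] by blast
    have "r (u @ a) (g i @ (b @ a))" using r_append[OF b(2), of a a] by simp
    with b that i show ?thesis unfolding C_def
      by (auto intro!: bexI[of _ "b @ a"])
  qed
  have O_0: "u \<notin> Ov 0" for u by (simp add: Ov_def)
  \<comment> \<open>By separation the two overlaps of a block are disjoint, so no vertex lies in
    three blocks.\<close>
  have O_disj: "u \<notin> Ov (Suc i)" if ui: "u \<in> Ov i" for u i
  proof
    assume u: "u \<in> Ov (Suc i)"
    obtain j where j: "i = Suc j" using ui O_0 by (cases i) auto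
    obtain a where a: "a \<in> lists (A j \<inter> A i)" "r u (g i @ a)" using O_E(1)[of u j] ui j by blast
    obtain b where b: "b \<in> lists (A i \<inter> A (Suc i))" "r u (g (Suc i) @ b)" "Suc i < n"
      using O_E[OF u] by blast
    have "r (g i @ a) (g (Suc i) @ b)" using a b r_sym r_trans by blast
    then show False using separated[of j a b] a b j by (auto simp: A_def)
  qed
  have O_sub: "u \<in> C i" "u \<in> C (Suc i)" if u: "u \<in> Ov (Suc i)" for u i
  proof -
    obtain b where b: "b \<in> lists (A i \<inter> A (Suc i))" "r u (g (Suc i) @ b)" "Suc i < n"
      using O_E[OF u] by blast
    then show "u \<in> C (Suc i)" by (auto simp: C_def)
    have "r (g (Suc i) @ b) ((g i @ w i) @ b)" using b by (intro r_append g) auto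
    then have "r u (g i @ (w i @ b))" using b r_trans by fastforce
    then show "u \<in> C i" using b w[of i]
      unfolding C_def by (auto intro!: bexI[of _ "w i @ b"] simp: A_def)
  qed
  have nu_eq: "nu i u = nu i v \<longleftrightarrow> r u v" for i u v
    using O_cong[of u v i] by (auto simp: nu_def nf_eq_iff)
  have nu_cong: "r u v \<Longrightarrow> nu i u = nu i v" for u v i by (simp add: nu_eq)
  have nu_O: "nu (Suc i) u = nu i u" if "u \<in> Ov (Suc i)" for u i
    using that O_disj[of u i] by (auto simp: nu_def)
  have nu_adj: "u \<in> Ov (Suc i)" if "nu i u = nu (Suc i) v" for u v i
    using that O_cong[of u v "Suc i"] O_0 by (cases i) (auto simp: nu_def nf_eq_iff split: if_splits)
  have nf_O: "nf u \<in> Ov i \<longleftrightarrow> u \<in> Ov i" for u i using O_cong r_nf by blast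
  have nf_app: "r (nf u @ a) (u @ a)" for u a
    using r_append[OF r_sym[OF r_nf], of a a] by simp
  have act_nu: "act e (nu i u) = nu i (u @ [e])" if e: "e \<in> A i" for e i u
  proof (cases "u \<in> Ov i")
    case False
    then show ?thesis using e by (simp add: nu_def[of i u] act_def nu_cong nf_app)
  next
    case True
    then obtain j where j: "i = Suc j" using O_0 by (cases i) auto
    show ?thesis
    proof (cases "e \<in> A j")
      case True
      have "u @ [e] \<in> Ov (Suc j)" using O_app[of u j "[e]"] \<open>u \<in> Ov i\<close> True e j by auto
      then show ?thesis using \<open>u \<in> Ov i\<close> True j nu_O[of "u @ [e]" j]
        by (simp add: nu_def[of "Suc j" u] act_def nu_cong nf_app)
    next
      case False
      then show ?thesis using \<open>u \<in> Ov i\<close> e j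
        by (simp add: nu_def[of "Suc j" u] act_def nu_cong nf_app nf_O)
    qed
  qed
  have fold_nu: "fold act a (nu i u) = nu i (u @ a)" if "a \<in> lists (A i)" for a i u
    using that by (induction a arbitrary: u) (auto simp: act_nu)
  \<comment> \<open>Both words lie in the same coset of the subgroup for
    \<open>A i \<inter> A (Suc i)\<close>, so \<open>a\<close> represents an element of that
    subgroup.\<close>
  have O_diff: "\<exists>c\<in>lists (A i \<inter> A (Suc i)). r c a" if u: "u \<in> Ov (Suc i)" "u @ a \<in> Ov (Suc i)" for u a i
  proof -
    obtain b c where b: "b \<in> lists (A i \<inter> A (Suc i))" "r u (g (Suc i) @ b)"
      and c: "c \<in> lists (A i \<inter> A (Suc i))" "r (u @ a) (g (Suc i) @ c)"
      using O_E(1)[OF u(1)] O_E(1)[OF u(2)] by blast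
    have "r (u @ rev b) (g (Suc i))" using b r_solve_left by blast
    then have "r ((u @ rev b) @ c) (g (Suc i) @ c)" by (rule r_append) simp
    then have "r (u @ (rev b @ c)) (u @ a)" using c(2) by (metis append.assoc r_sym r_trans)
    then have "r (rev b @ c) a" by (simp add: r_cancel_left)
    moreover have "rev b @ c \<in> lists (A i \<inter> A (Suc i))" using b(1) c(1) by auto
    ultimately show ?thesis by blast
  qed
  have chain: "chain_graph E N k r A V act"
  proof
    fix i
    show "A i \<subseteq> E" "card (A i) \<le> k" using alpha by (auto simp: A_def)
  next
    show "i < N" if "x \<in> V i" for x i using that n by (auto simp: V_def C_def)
  next
    fix x i e assume "x \<in> V i" "e \<in> A i"
    then show "act e x \<in> V i" using C_app[of _ i "[e]"] by (auto simp: V_def act_nu)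
  next
    fix x i a b assume x: "x \<in> V i" and a: "a \<in> lists (A i)" and b: "b \<in> lists (A i)"
    obtain u where "x = nu i u" using x by (auto simp: V_def)
    then show "fold act a x = fold act b x \<longleftrightarrow> r a b"
      using fold_nu[OF a] fold_nu[OF b] by (simp add: nu_eq r_cancel_left)
  next
    fix x i e assume x: "x \<in> V i" and *: "\<And>j. x \<in> V j \<Longrightarrow> e \<notin> A j"
    obtain j u where ju: "x = (j, u)" by (cases x)
    obtain v where v: "v \<in> C i" "x = nu i v" using x by (auto simp: V_def)
    have "x \<in> V j"
    proof (cases "v \<in> Ov i")
      case True
      then obtain l where "i = Suc l" using O_0 by (cases i) auto
      then show ?thesis using True v ju nu_O[of v l] O_sub[of v l] by (auto simp: V_def nu_def)
    next
      case False
      then show ?thesis using x v ju by (simp add: nu_def)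
    qed
    then have 1: "e \<notin> A j" using * by simp
    have "e \<notin> A (Suc j)" if "u \<in> Ov (Suc j)"
    proof -
      have "nf u = u" using v ju by (simp add: nu_def nf_eq_iff r_sym[OF r_nf])
      moreover have "u \<notin> Ov j" using that O_disj by blast
      ultimately have "x = nu (Suc j) u" using that ju by (simp add: nu_def)
      then show ?thesis using * O_sub[OF that] by (auto simp: V_def)
    qed
    with 1 show "act e x = x" by (auto simp: act_def ju)
  next
    fix x i j assume "x \<in> V i" "x \<in> V j"
    then show "i \<le> Suc j" by (auto simp: V_def nu_def split: if_splits)
  next
    fix x i j a
    assume x: "x \<in> V i" "x \<in> V j" and a: "a \<in> lists (A i)" "fold act a x \<in> V j"
    have "i \<le> Suc j" "j \<le> Suc i" using x by (auto simp: V_def nu_def split: if_splits)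
    then consider "i = j" | "j = Suc i" | "i = Suc j" by linarith
    then show "\<exists>c\<in>lists (A i \<inter> A j). fold act c x = fold act a x"
    proof cases
      case 1
      then show ?thesis using a by auto
    next
      case 2
      obtain u where u: "x = nu i u" using x by (auto simp: V_def)
      have "u \<in> Ov (Suc i)" "u @ a \<in> Ov (Suc i)"
        using x(2) a nu_adj[of i] by (auto simp: V_def 2 u fold_nu simp del: in_lists_conv_set)
      then obtain c where c: "c \<in> lists (A i \<inter> A (Suc i))" "r c a" using O_diff by blast
      then have "fold act c x = fold act a x"
        using a by (subst (1 2) u, subst (1 2) fold_nu) (auto simp: nu_eq r_cancel_left)
      with c 2 show ?thesis by blast
    next
      case 3
      obtain u where u: "x = nu i u" using x by (auto simp: V_def)
      have adj: "v \<in> Ov (Suc j)" if v: "nu (Suc j) v \<in> V j" for v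
      proof -
        obtain v' where v': "nu (Suc j) v = nu j v'" using v unfolding V_def by blast
        then have "v' \<in> Ov (Suc j)" using nu_adj by metis
        moreover have "r v v'" using v' by (simp add: nu_def nf_eq_iff)
        ultimately show ?thesis using O_cong by blast
      qed
      have "u \<in> Ov (Suc j)" "u @ a \<in> Ov (Suc j)"
        using x(2) a by (auto simp: adj 3 u fold_nu simp del: in_lists_conv_set)
      then obtain c where c: "c \<in> lists (A j \<inter> A (Suc j))" "r c a" using O_diff by blast
      then have "fold act c x = fold act a x"
        using a 3 by (subst (1 2) u, subst (1 2) fold_nu) (auto simp: nu_eq r_cancel_left)
      with c 3 show ?thesis by (metis inf_commute)
    qed
  qed
  define W where "W i = concat (map w [0..<i])" for i
  have W_Suc: "W (Suc i) = W i @ w i" for i by (simp add: W_def)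
  have g_W: "i \<le> n \<Longrightarrow> r (g i) (g 0 @ W i)" for i
  proof (induction i)
    case (Suc i)
    have "r (g i @ w i) ((g 0 @ W i) @ w i)" using Suc by (intro r_append) auto
    moreover have "r (g (Suc i)) (g i @ w i)" using g[of i] Suc.prems by simp
    ultimately have "r (g (Suc i)) ((g 0 @ W i) @ w i)" using r_trans by blast
    then show ?case by (simp add: W_Suc)
  qed (simp add: W_def)
  have g_O: "g (Suc i) \<in> Ov (Suc i)" if "Suc i < n" for i
    using that unfolding Ov_def by (auto intro!: bexI[of _ "[]"])
  have wA: "w i \<in> lists (A i)" if "i < n" for i using w that by (simp add: A_def)
  \<comment> \<open>At the end of \<open>w i\<close> the vertex lies in the overlap and is read
    again as a vertex of block \<open>Suc i\<close>.\<close>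
  have walk: "i < n \<Longrightarrow> fold act (W i) (nu 0 (g 0)) = nu i (g i)" for i
  proof (induction i)
    case (Suc i)
    then have "fold act (W (Suc i)) (nu 0 (g 0)) = nu i (g i @ w i)"
      using fold_nu[OF wA, of i] by (simp add: W_Suc)
    also have "\<dots> = nu i (g (Suc i))" using g[of i] Suc.prems by (simp add: nu_eq r_sym)
    finally show ?case using nu_O[OF g_O] Suc.prems by simp
  qed (simp add: W_def)
  obtain m where m: "n = Suc m" using n by (cases n) auto
  have end_W: "fold act (W n) (nu 0 (g 0)) = nu m (g n)"
    using walk[of m] fold_nu[OF wA, of m] g[of m] m by (simp add: W_Suc nu_eq r_sym)
  have "r (g 0 @ W n) (g 0 @ [])" using g_W[of n] cyclic r_sym r_trans by (metis append_Nil2 order_refl)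
  then have "r (W n) []" by (simp only: r_cancel_left)
  moreover have "nu 0 (g 0) \<in> V 0" using n unfolding V_def C_def by (auto intro!: bexI[of _ "[]"])
  ultimately have "nu m (g n) = nu 0 (g 0)"
    using tame chain end_W unfolding tame_def by fastforce
  \<comment> \<open>The start has tag 0; the end has tag \<open>m\<close>, which is at least 1, or
    \<open>m - 1\<close> if it lies in \<open>Ov m\<close>.\<close>
  then have "g n \<in> Ov m" "m = 1" using m n by (auto simp: nu_def O_0 split: if_splits)
  then have "g 0 \<in> Ov 1" using cyclic O_cong by blast
  then show ?thesis using \<open>m = 1\<close> m by (auto simp: Ov_def A_def)
qed

text \<open>The closed walk \<open>a\<close>, then \<open>rev b\<close>, runs through a chain of two
  blocks labelled \<open>A\<close> and \<open>B\<close>, so its start lies in their overlap.\<close>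

lemma (in involutive_cong) tame_intersection:
  assumes "tame E N k r" "2 \<le> N"
    and "A \<subseteq> E" "card A \<le> k" "B \<subseteq> E" "card B \<le> k"
    and "a \<in> lists A" "b \<in> lists B" "r a b"
  shows "\<exists>d\<in>lists (A \<inter> B). r a d"
proof -
  define g where "g i = (if i = 1 then a else [])" for i :: nat
  define w where "w i = (if i = 0 then a else rev b)" for i :: nat
  have "r (b @ rev b) (a @ rev b)" by (rule r_append) (use assms r_sym in auto)
  then have c: "r [] (a @ rev b)" using r_append_rev r_sym r_trans by blast
  have "2 = (2::nat) \<and> (\<exists>d\<in>lists ((if (0::nat) = 0 then A else B) \<inter> (if (1::nat) = 0 then A else B)).
     r (g 0) (g 1 @ d))"
    by (rule tame_no_coset_chain[where N = N and k = k and w = w])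
      (use assms c in \<open>auto simp: g_def w_def less_Suc_eq numeral_2_eq_2 split: if_splits\<close>)
  then obtain d where d: "d \<in> lists (A \<inter> B)" "r [] (a @ d)" by (auto simp: g_def)
  have "r ([] @ rev d) a" using r_solve_left d(2) by blast
  then show ?thesis using d(1) by (intro bexI[of _ "rev d"]) (auto intro: r_sym)
qed

section \<open>Raising the rank\<close>

text \<open>Restricting a chain graph of rank \<open>Suc k\<close> to at most \<open>Suc k\<close> generators yields a chain graph
  of rank \<open>k\<close>, apart from blocks on which the restricted words act through \<open>r\<close> anyway.\<close>

lemma (in involutive_cong) tame_small_words:
  fixes act :: "'e \<Rightarrow> nat \<times> 'e list \<Rightarrow> nat \<times> 'e list"
  assumes tame: "tame E N k r" and N: "2 \<le> N"
    and chain: "chain_graph E N (Suc k) r \<alpha> V act" and x: "x \<in> V i"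
    and B: "B \<subseteq> E" "card B \<le> Suc k" and ab: "a \<in> lists B" "b \<in> lists B" "r a b"
  shows "fold act a x = fold act b x"
proof -
  interpret chain_graph E N "Suc k" r \<alpha> V act by (rule chain)
  \<comment> \<open>On a block whose label set contains \<open>B\<close>, \<open>free\<close>
    settles the claim directly.\<close>
  define bad where "bad = (\<Union>j\<in>{j. B \<subseteq> \<alpha> j}. V j)"
  show ?thesis
  proof (cases "x \<in> bad")
    case True
    then obtain j where "x \<in> V j" "B \<subseteq> \<alpha> j" by (auto simp: bad_def)
    then show ?thesis using free[of x j a b] ab lists_mono by blast
  next
    case False
    \<comment> \<open>If \<open>B \<subseteq> \<alpha> i\<close>, the block loses all its vertices
      and its labels are emptied as well; otherwise \<open>B \<inter> \<alpha> i\<close> is a proper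
      subset of \<open>B\<close>. Either way at most \<open>k\<close> letters remain.\<close>
    define A where "A i = (if B \<subseteq> \<alpha> i then {} else B \<inter> \<alpha> i)" for i
    define U where "U i = V i - bad" for i
    define act' where "act' e = (if e \<in> B then act e else id)" for e
    have fold_eq: "fold act' c y = fold act c y" if "c \<in> lists B" for c y
      using that by (induction c arbitrary: y) (auto simp: act'_def)
    have A_sub: "A i \<subseteq> B" "A i \<subseteq> \<alpha> i" for i by (auto simp: A_def)
    have lists_A: "c \<in> lists (A i) \<Longrightarrow> c \<in> lists B" "c \<in> lists (A i) \<Longrightarrow> c \<in> lists (\<alpha> i)" for c i
      using A_sub lists_mono by blast+
    have U_A: "A i = B \<inter> \<alpha> i" "\<not> B \<subseteq> \<alpha> i" if "y \<in> U i" for y i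
      using that by (auto simp: U_def A_def bad_def)
    have fin: "finite C" if "C \<subseteq> E" for C using that finite_E finite_subset by blast
    have card_A: "card (A i) \<le> k" for i
    proof (cases "B \<subseteq> \<alpha> i")
      case False
      then have "card (B \<inter> \<alpha> i) < card B" by (intro psubset_card_mono fin B) auto
      then show ?thesis using B False by (simp add: A_def)
    qed (simp add: A_def)
    have "chain_graph E N k r A U act'"
    proof
      show "A i \<subseteq> E" for i using A_sub B by blast
      show "card (A i) \<le> k" for i by (rule card_A)
      show "i < N" if "y \<in> U i" for y i using that bounded[of y i] by (simp add: U_def)
    next
      fix y i e assume y: "y \<in> U i" and e: "e \<in> A i"
      then have e': "e \<in> B" "e \<in> \<alpha> i" using A_sub by auto
      have yi: "y \<in> V i" using y by (simp add: U_def)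
      have ee: "act e (act e y) = y" using free[OF yi, of "[e, e]" "[]"] e' r_square by simp
      \<comment> \<open>Letters of \<open>B\<close> preserve the bad blocks, and a second
        application of \<open>e\<close> would bring \<open>y\<close> back into one.\<close>
      have "act e y \<notin> bad"
      proof
        assume "act e y \<in> bad"
        then obtain j where "act e y \<in> V j" "B \<subseteq> \<alpha> j" by (auto simp: bad_def)
        then have "y \<in> bad" using closed[of "act e y" j e] e' ee by (auto simp: bad_def)
        then show False using y by (simp add: U_def)
      qed
      then show "act' e y \<in> U i" using closed[OF yi e'(2)] e' by (simp add: act'_def U_def)
    next
      fix y i c d assume "y \<in> U i" "c \<in> lists (A i)" "d \<in> lists (A i)"
      then show "fold act' c y = fold act' d y \<longleftrightarrow> r c d"
        using free[of y i c d] fold_eq lists_A by (metis DiffD1 U_def)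
    next
      fix y i e assume y: "y \<in> U i" and *: "\<And>j. y \<in> U j \<Longrightarrow> e \<notin> A j"
      show "act' e y = y"
      proof (cases "e \<in> B")
        case True
        have "e \<notin> \<alpha> j" if "y \<in> V j" for j
        proof -
          have "y \<in> U j" using that y by (simp add: U_def)
          then show ?thesis using * U_A True by blast
        qed
        then show ?thesis using trivial[of y i e] y by (auto simp: act'_def U_def)
      qed (simp add: act'_def)
    next
      show "i \<le> Suc j" if "y \<in> U i" "y \<in> U j" for y i j
        using that linear[of y i j] by (simp add: U_def)
    next
      fix y i j c
      assume y: "y \<in> U i" "y \<in> U j" and c: "c \<in> lists (A i)" and cj: "fold act' c y \<in> U j"
      have y': "y \<in> V i" "y \<in> V j" and cj': "fold act c y \<in> V j"
        using y cj fold_eq lists_A(1)[OF c] by (auto simp: U_def)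
      obtain d where d: "d \<in> lists (\<alpha> i \<inter> \<alpha> j)" "fold act d y = fold act c y"
        using overlap[OF y' lists_A(2)[OF c] cj'] by blast
      have d': "d \<in> lists (\<alpha> i)" using d(1) by auto
      have rcd: "r c d" using free[OF y'(1) lists_A(2)[OF c] d'] d(2) by simp
      \<comment> \<open>The overlap word \<open>d\<close> may use letters outside \<open>B\<close>,
        but it is equivalent to \<open>c\<close> over \<open>A i\<close>. Unless
        \<open>\<alpha> i \<subseteq> \<alpha> j\<close>, the set
        \<open>\<alpha> i \<inter> \<alpha> j\<close> has at most \<open>k\<close> letters, and the
        intersection property at rank \<open>k\<close> gives a common word.\<close>
      have "\<exists>f\<in>lists (A i \<inter> (\<alpha> i \<inter> \<alpha> j)). r c f"
      proof (cases "\<alpha> i \<subseteq> \<alpha> j")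
        case True
        then have "A i \<inter> (\<alpha> i \<inter> \<alpha> j) = A i" using A_sub by blast
        then show ?thesis using c by (intro bexI[of _ c]) auto
      next
        case False
        then have "card (\<alpha> i \<inter> \<alpha> j) < card (\<alpha> i)"
          by (intro psubset_card_mono fin alpha) auto
        then have "card (\<alpha> i \<inter> \<alpha> j) \<le> k" using alpha(2)[of i] by simp
        moreover have "A i \<subseteq> E" "\<alpha> i \<inter> \<alpha> j \<subseteq> E" using alpha(1) A_sub by blast+
        ultimately show ?thesis
          using tame_intersection[OF tame N _ card_A _ _ c d(1) rcd] by blast
      qed
      then obtain f where f: "f \<in> lists (A i \<inter> (\<alpha> i \<inter> \<alpha> j))" "r c f" by blast
      have "A i \<inter> (\<alpha> i \<inter> \<alpha> j) = A i \<inter> A j" using U_A(1)[OF y(1)] U_A(1)[OF y(2)] by blast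
      then have f': "f \<in> lists (A i \<inter> A j)" using f(1) by simp
      then have fi: "f \<in> lists (A i)" by auto
      have "fold act f y = fold act c y"
        using free[OF y'(1) lists_A(2)[OF fi] lists_A(2)[OF c]] f(2) r_sym by blast
      then show "\<exists>f\<in>lists (A i \<inter> A j). fold act' f y = fold act' c y"
        using f' fold_eq[OF lists_A(1)[OF fi]] fold_eq[OF lists_A(1)[OF c]] by metis
    qed
    moreover have "x \<in> U i" using x False by (simp add: U_def)
    ultimately have "fold act' a x = fold act' b x" using tame ab(3) unfolding tame_def by blast
    then show ?thesis using fold_eq ab by simp
  qed
qed

text \<open>A component of a chain graph is swept out by two monotone walks from any of its vertices,
  which visit every block at most once.\<close>

lemma (in involutive_cong) finite_reaching_words:
  obtains W where "finite W" "[] \<in> W"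
    "\<And>k \<alpha> V (act :: 'e \<Rightarrow> 'v \<Rightarrow> 'v) i x u. chain_graph E N k r \<alpha> V act \<Longrightarrow> x \<in> V i \<Longrightarrow>
       \<exists>w\<in>W. fold act u x = fold act w x"
proof -
  obtain Rep where Rep: "finite Rep" "[] \<in> Rep"
    "\<And>A a. A \<subseteq> E \<Longrightarrow> a \<in> lists A \<Longrightarrow> \<exists>b\<in>Rep. b \<in> lists A \<and> r a b"
    by (rule finite_representatives) blast
  \<comment> \<open>\<open>W l\<close> consists of products of \<open>l + 1\<close> representatives,
    one for each block visited, whatever the chain graph.\<close>
  define W where "W = rec_nat Rep (\<lambda>_ S. (\<lambda>(w, a). w @ a) ` (S \<times> Rep))"
  have W_0: "W 0 = Rep" and W_Suc: "W (Suc l) = (\<lambda>(w, a). w @ a) ` (W l \<times> Rep)" for l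
    by (simp_all add: W_def)
  have fin: "finite (W l)" for l by (induction l) (use Rep in \<open>auto simp: W_0 W_Suc\<close>)
  define WW where "WW = (\<Union>l\<le>N. W l)"
  have "\<exists>w\<in>WW. fold act u x = fold act w x"
    if chain: "chain_graph E N k r \<alpha> V act" and x: "x \<in> V i"
    for k \<alpha> V and act :: "'e \<Rightarrow> 'v \<Rightarrow> 'v" and i x u
  proof -
    interpret chain_graph E N k r \<alpha> V act by (rule chain)
    \<comment> \<open>\<open>S up l\<close> below collects the vertices reached by moving
      \<open>l\<close> blocks in one direction. Its guard \<open>up \<or> l < i\<close> keeps the
      truncated subtraction from repeating block 0.\<close>
    define nb where "nb up l = (if up then i + l else i - l)" for up l
    define S where "S up l = rec_nat {fold act a x |a. a \<in> lists (\<alpha> i)}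
      (\<lambda>l T. {fold act a y |y a. y \<in> T \<and> y \<in> V (nb up (Suc l)) \<and> (up \<or> l < i) \<and> a \<in> lists (\<alpha> (nb up (Suc l)))}) l"
      for up l
    have S_0: "S up 0 = {fold act a x |a. a \<in> lists (\<alpha> i)}"
      and S_Suc: "S up (Suc l) = {fold act a y |y a. y \<in> S up l \<and> y \<in> V (nb up (Suc l)) \<and> (up \<or> l < i)
        \<and> a \<in> lists (\<alpha> (nb up (Suc l)))}" for up l
      by (simp_all add: S_def)
    have nb_0: "nb up 0 = i" for up by (simp add: nb_def)
    have S_V: "y \<in> V (nb up l)" if "y \<in> S up l" for y up l
      using that x by (cases l) (auto simp: S_0 S_Suc nb_0 intro!: fold_closed)
    have S_fold: "fold act c y \<in> S up l" if y: "y \<in> S up l" and "c \<in> lists (\<alpha> (nb up l))" for y up l c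
    proof (cases l)
      case 0
      then obtain a where "y = fold act a x" "a \<in> lists (\<alpha> i)" using y unfolding 0 S_0 by blast
      then show ?thesis using that 0 unfolding S_0 nb_0
        by (auto intro!: exI[of _ "a @ c"] simp: S_0 nb_0)
    next
      case (Suc m)
      then obtain a z where "y = fold act a z" "a \<in> lists (\<alpha> (nb up l))" "z \<in> S up m"
        "z \<in> V (nb up l)" "up \<or> m < i" using y unfolding Suc S_Suc by blast
      moreover from this have "a @ c \<in> lists (\<alpha> (nb up l))" using that(2) by simp
      ultimately have "fold act (a @ c) z \<in> S up (Suc m)" unfolding S_Suc Suc by blast
      then show ?thesis using \<open>y = fold act a z\<close> Suc by simp
    qed
    have S_W: "\<exists>w\<in>W l. y = fold act w x" if "y \<in> S up l" for y up l
      using that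
    proof (induction l arbitrary: y)
      case 0
      then obtain a where a: "y = fold act a x" "a \<in> lists (\<alpha> i)" unfolding S_0 by blast
      obtain b where "b \<in> Rep" "b \<in> lists (\<alpha> i)" "r a b" using Rep(3)[OF alpha(1) a(2)] by blast
      then show ?case using free[OF x a(2)] a(1) W_0 by blast
    next
      case (Suc l)
      then obtain a z where a: "y = fold act a z" "a \<in> lists (\<alpha> (nb up (Suc l)))" "z \<in> S up l"
        "z \<in> V (nb up (Suc l))" unfolding S_Suc by blast
      obtain b where b: "b \<in> Rep" "b \<in> lists (\<alpha> (nb up (Suc l)))" "r a b"
        using Rep(3)[OF alpha(1) a(2)] by blast
      obtain w where w: "w \<in> W l" "z = fold act w x" using Suc.IH a(3) by blast
      have "y = fold act (w @ b) x" using free[OF a(4,2) b(2)] a(1) b(3) w(2) by simp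
      then show ?case using w b W_Suc by force
    qed
    have S_N: "l \<le> N" if "y \<in> S up l" for y up l
    proof (cases up)
      case True
      then show ?thesis using bounded[OF S_V[OF that]] by (simp add: nb_def)
    next
      case False
      then have "l \<le> i" using that by (cases l) (auto simp: S_Suc)
      then show ?thesis using bounded[OF x] by simp
    qed
    define D where "D = (\<Union>up. \<Union>l. S up l)"
    \<comment> \<open>The letter \<open>e\<close> may belong to the current block, the next one, the
      first one in the opposite direction, or the previous one.\<close>
    have D_act: "act e y \<in> D" if "y \<in> D" for e y
    proof -
      obtain up l where yS: "y \<in> S up l" using \<open>y \<in> D\<close> by (auto simp: D_def)
      have step: "act e y \<in> D" if "z \<in> S up' l'" "e \<in> \<alpha> (nb up' l')" "z = y" for z up' l'
        using S_fold[OF that(1), of "[e]"] that by (auto simp: D_def)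
      show ?thesis
      proof (cases "\<exists>j. y \<in> V j \<and> e \<in> \<alpha> j")
        case False
        then show ?thesis using trivial[OF S_V[OF yS]] that by metis
      next
        case True
        then obtain j where j: "y \<in> V j" "e \<in> \<alpha> j" by blast
        have dn: "up \<or> l \<le> i" using yS by (cases l) (auto simp: S_Suc)
        have "j \<le> Suc (nb up l)" "nb up l \<le> Suc j" using linear j S_V[OF yS] by blast+
        then consider "j = nb up l" | "j = nb up (Suc l)" "up \<or> l < i"
          | "l = 0" "j = nb (\<not> up) 1" "\<not> up \<or> 0 < i"
          | m where "l = Suc m" "j = nb up m"
        proof -
          have "j = nb up l \<or> (j = nb up (Suc l) \<and> (up \<or> l < i)) \<or> (l = 0 \<and> j = nb (\<not> up) 1 \<and> (\<not> up \<or> 0 < i))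
             \<or> (\<exists>m. l = Suc m \<and> j = nb up m)"
            using \<open>j \<le> Suc (nb up l)\<close> \<open>nb up l \<le> Suc j\<close> dn
            by (cases l; cases up) (auto simp: nb_def)
          then show thesis using that by blast
        qed
        then show ?thesis
        proof cases
          case 1
          then show ?thesis using step yS j by blast
        next
          case 2
          then have "fold act [] y \<in> S up (Suc l)" unfolding S_Suc using yS j
            by (auto intro!: exI[of _ y] exI[of _ "[]"])
          then show ?thesis using step[of _ up "Suc l"] j 2 by simp
        next
          case 3
          have "y \<in> S (\<not> up) 0" using yS 3 by (simp add: S_0)
          then have "fold act [] y \<in> S (\<not> up) (Suc 0)" unfolding S_Suc using 3 j
            by (auto intro!: exI[of _ y] exI[of _ "[]"])
          then show ?thesis using step[of _ "\<not> up" "Suc 0"] j 3 by simp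
        next
          case 4
          then obtain a z where a: "y = fold act a z" "a \<in> lists (\<alpha> (nb up l))" "z \<in> S up m"
            "z \<in> V (nb up l)" using yS unfolding 4(1) S_Suc by blast
          have zj: "z \<in> V j" using S_V[OF a(3)] 4 by simp
          \<comment> \<open>In a step back, \<open>overlap\<close> replaces the last segment by a
            word over the previous block as well, so \<open>y\<close> already belongs to
            \<open>S up m\<close>.\<close>
          obtain c where c: "c \<in> lists (\<alpha> (nb up l) \<inter> \<alpha> j)" "fold act c z = y"
            using overlap[OF a(4) zj a(2)] a(1) j(1) by auto
          have "y \<in> S up m" using S_fold[OF a(3), of c] c 4 by auto
          then show ?thesis using step[of y up m] j 4 by simp
        qed
      qed
    qed
    have "fold act [] x \<in> S True 0" unfolding S_0 by (auto intro!: exI[of _ "[]"])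
    then have "x \<in> D" by (auto simp: D_def)
    have "fold act u y \<in> D" if "y \<in> D" for y
      using that by (induction u arbitrary: y) (auto intro: D_act)
    then have "fold act u x \<in> D" using \<open>x \<in> D\<close> by blast
    then obtain up l where l: "fold act u x \<in> S up l" by (auto simp: D_def)
    then show ?thesis using S_W[OF l] S_N[OF l] by (auto simp: WW_def)
  qed
  moreover have "finite WW" using fin by (simp add: WW_def)
  moreover have "[] \<in> WW" using Rep W_0 by (auto simp: WW_def)
  ultimately show ?thesis using that[of WW] by blast
qed

section \<open>Finite index of the refinement\<close>

lemma finite_range_factor:
  assumes "finite (range f)" and "\<And>u v. f u = f v \<Longrightarrow> g u = g v"
  shows "finite (range g)"
proof (rule finite_surj[OF assms(1)])
  show "range g \<subseteq> (\<lambda>y. g (inv_into UNIV f y)) ` range f"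
  proof
    fix z assume "z \<in> range g"
    then obtain u where "z = g u" by blast
    moreover have "f (inv_into UNIV f (f u)) = f u" by (rule f_inv_into_f) simp
    ultimately have "z = g (inv_into UNIV f (f u))" using assms(2) by metis
    then show "z \<in> (\<lambda>y. g (inv_into UNIV f y)) ` range f" by blast
  qed
qed

text \<open>The vertices reachable from \<open>x\<close> are named by words of a finite set
  \<open>W\<close> common to all chain graphs, so finitely many transition tables describe all
  actions. The \<open>r\<close>-class of a word and its runs through all tables determine its
  refined class.\<close>

lemma (in involutive_cong) finite_index_refine:
  "finite (range (\<lambda>u. Collect (refine E N k r u)))"
proof -
  obtain W :: "'e list set" where W: "finite W" "[] \<in> W"
    "\<And>k \<alpha> V (act :: 'e \<Rightarrow> nat \<times> 'e list \<Rightarrow> _) i x u. chain_graph E N k r \<alpha> V act \<Longrightarrow> x \<in> V i \<Longrightarrow>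
       \<exists>w\<in>W. fold act u x = fold act w x"
    by (rule finite_reaching_words) blast
  text \<open>A transition table \<open>t\<close> records \<open>act\<close> on the component of a vertex \<open>x\<close>, the word \<open>w\<close>
    standing for the vertex reached from \<open>x\<close> along \<open>w\<close>.\<close>
  define T where "T = (W \<times> E \<rightarrow>\<^sub>E W)"
  \<comment> \<open>The run starts at \<open>[]\<close>, the name of \<open>x\<close>; letters
    outside \<open>E\<close> keep the state, since they fix all vertices.\<close>
  define run where "run t u = fold (\<lambda>e w. if e \<in> E then t (w, e) else w) u []"
    for t :: "'e list \<times> 'e \<Rightarrow> 'e list" and u
  have run_W: "run t u \<in> W" if "t \<in> T" for t u
  proof (induction u rule: rev_induct)
    case (snoc e u)
    then show ?case using that by (auto simp: run_def T_def PiE_iff)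
  qed (simp add: run_def W)
  have table: "\<exists>t\<in>T. \<forall>u. fold act (run t u) x = fold act u x"
    if chain: "chain_graph E N k r \<alpha> V act" and x: "x \<in> V i"
    for \<alpha> V i x and act :: "'e \<Rightarrow> nat \<times> 'e list \<Rightarrow> nat \<times> 'e list"
  proof -
    interpret chain_graph E N k r \<alpha> V act by (rule chain)
    have "\<exists>w'. w' \<in> W \<and> fold act (w @ [e]) x = fold act w' x" for w e
      using W(3)[OF chain x] by blast
    then obtain s where s: "s w e \<in> W" "fold act (w @ [e]) x = fold act (s w e) x" for w e
      by metis
    define t where "t = restrict (\<lambda>(w, e). s w e) (W \<times> E)"
    have t: "t \<in> T" using s by (auto simp: t_def T_def)
    have "fold act (run t u) x = fold act u x" for u
    proof (induction u rule: rev_induct)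
      case (snoc e u)
      show ?case
      proof (cases "e \<in> E")
        case True
        then have "run t (u @ [e]) = s (run t u) e"
          using run_W[OF t, of u] by (simp add: run_def t_def)
        then show ?thesis using s(2)[of "run t u" e] snoc by simp
      next
        case False
        obtain j where "fold act u x \<in> V j" using fold_in[OF x] by blast
        then have "act e (fold act u x) = fold act u x" using trivial alpha(1) False by blast
        then show ?thesis using snoc False by (simp add: run_def)
      qed
    qed (simp add: run_def)
    with t show ?thesis by blast
  qed
  define F where "F u = (restrict (\<lambda>t. run t u) T, Collect (r u))" for u
  have "F ` UNIV \<subseteq> (T \<rightarrow>\<^sub>E W) \<times> range (\<lambda>u. Collect (r u))"
    using run_W by (auto simp: F_def)
  moreover have "finite ((T \<rightarrow>\<^sub>E W) \<times> range (\<lambda>u. Collect (r u)))"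
    using W(1) finite_E finite_index by (auto simp: T_def intro!: finite_PiE)
  ultimately have "finite (range F)" using finite_subset by blast
  then show ?thesis
  proof (rule finite_range_factor)
    fix u v assume F: "F u = F v"
    then have "Collect (r u) = Collect (r v)" by (simp add: F_def)
    then have "r u = r v" by (auto simp: Collect_inj)
    have "run t u = run t v" if "t \<in> T" for t
      using F that by (auto simp: F_def dest!: fun_cong[of _ _ t])
    then have "fold act u x = fold act v x" if "chain_graph E N k r \<alpha> V act" "x \<in> V i"
      for \<alpha> V i x and act :: "'e \<Rightarrow> nat \<times> 'e list \<Rightarrow> nat \<times> 'e list"
      using table[OF that] by metis
    then have "refine E N k r u w \<longleftrightarrow> refine E N k r v w" for w
      unfolding refine_def \<open>r u = r v\<close> by metis
    then show "Collect (refine E N k r u) = Collect (refine E N k r v)"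
      by (intro arg_cong[of _ _ Collect] ext)
  qed
qed

section \<open>Congruence, tameness and symmetries of the refinement\<close>

lemma (in involutive_cong) refine_cong: "involutive_cong E (refine E N k r)"
proof
  fix u v u' v'
  assume uv: "refine E N k r u v" and uv': "refine E N k r u' v'"
  show "refine E N k r (u @ u') (v @ v')"
    unfolding refine_def
  proof (intro conjI allI impI)
    show "r (u @ u') (v @ v')" using uv uv' r_append by (simp add: refine_def)
  next
    fix \<alpha> V i x and act :: "'e \<Rightarrow> nat \<times> 'e list \<Rightarrow> nat \<times> 'e list"
    assume c: "chain_graph E N k r \<alpha> V act" and x: "x \<in> V i"
    \<comment> \<open>The vertex reached by \<open>u\<close> lies in a block again, so the relation
      between \<open>u'\<close> and \<open>v'\<close> applies to it.\<close>
    obtain j where j: "fold act u x \<in> V j" using chain_graph.fold_in[OF c x] by blast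
    have "fold act u x = fold act v x" using uv c x unfolding refine_def by blast
    moreover have "fold act u' (fold act u x) = fold act v' (fold act u x)"
      using uv' c j unfolding refine_def by blast
    ultimately show "fold act (u @ u') x = fold act (v @ v') x" by simp
  qed
next
  show "refine E N k r [e, e] []" for e
    unfolding refine_def
  proof (intro conjI allI impI)
    fix \<alpha> V i x and act :: "'e \<Rightarrow> nat \<times> 'e list \<Rightarrow> nat \<times> 'e list"
    assume c: "chain_graph E N k r \<alpha> V act" and x: "x \<in> V i"
    interpret chain_graph E N k r \<alpha> V act by (rule c)
    show "fold act [e, e] x = fold act [] x"
    proof (cases "\<exists>j. x \<in> V j \<and> e \<in> \<alpha> j")
      case True
      then obtain j where "x \<in> V j" "e \<in> \<alpha> j" by blast
      then show ?thesis using free[of x j "[e, e]" "[]"] r_square by simp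
    next
      case False
      then have "act e x = x" using trivial[OF x] by blast
      then show ?thesis by simp
    qed
  qed (rule r_square)
next
  fix e assume e: "e \<notin> E"
  show "refine E N k r [e] []"
    unfolding refine_def
  proof (intro conjI allI impI)
    fix \<alpha> V i x and act :: "'e \<Rightarrow> nat \<times> 'e list \<Rightarrow> nat \<times> 'e list"
    assume c: "chain_graph E N k r \<alpha> V act" and x: "x \<in> V i"
    interpret chain_graph E N k r \<alpha> V act by (rule c)
    show "fold act [e] x = fold act [] x" using trivial[OF x] alpha(1) e by auto
  qed (rule r_outside[OF e])
next
  show "refine E N k r u w" if "refine E N k r u v" "refine E N k r v w" for u v w
    using that r_trans unfolding refine_def by metis
  show "refine E N k r v u" if "refine E N k r u v" for u v
    using that r_sym unfolding refine_def by metis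
qed (use finite_E finite_index_refine in \<open>auto simp: refine_def\<close>)

text \<open>On words over at most \<open>Suc k\<close> letters the refinement agrees with
  \<open>r\<close>, by \<open>tame_small_words\<close>. So its chain graphs are chain graphs for
  \<open>r\<close>, on which it acts by construction.\<close>

lemma (in involutive_cong) tame_refine:
  assumes "tame E N k r" "2 \<le> N"
  shows "tame E N (Suc k) (refine E N (Suc k) r)"
  unfolding tame_def
proof (intro allI impI)
  fix \<alpha> V i x u v and act :: "'e \<Rightarrow> nat \<times> 'e list \<Rightarrow> nat \<times> 'e list"
  assume c: "chain_graph E N (Suc k) (refine E N (Suc k) r) \<alpha> V act"
    and x: "x \<in> V i" and uv: "refine E N (Suc k) r u v"
  have "chain_graph E N (Suc k) r \<alpha> V act"
    by (rule chain_graph.mono_rank[OF c])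
      (use tame_small_words[OF assms] in \<open>simp (no_asm_simp) only: refine_def; blast\<close>)
  then show "fold act u x = fold act v x" using uv x unfolding refine_def by blast
qed

text \<open>A chain graph relabelled along \<open>\<rho>\<close> is one for the same congruence, so
  the condition at \<open>map \<rho> u\<close> is an instance of the one at
  \<open>u\<close>.\<close>

lemma refine_permute_imp:
  assumes "\<rho> permutes E" and "\<And>u v. r (map \<rho> u) (map \<rho> v) \<longleftrightarrow> r u v"
    and "refine E N k r u v"
  shows "refine E N k r (map \<rho> u) (map \<rho> v)"
  unfolding refine_def
proof (intro conjI allI impI)
  fix \<alpha> V i x and act :: "'a \<Rightarrow> nat \<times> 'a list \<Rightarrow> nat \<times> 'a list"
  assume c: "chain_graph E N k r \<alpha> V act" and x: "x \<in> V i"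
  have "fold (\<lambda>e. act (\<rho> e)) u x = fold (\<lambda>e. act (\<rho> e)) v x"
    using assms(3) chain_graph.permute[OF c assms(1,2)] x unfolding refine_def by blast
  then show "fold act (map \<rho> u) x = fold act (map \<rho> v) x" by (simp add: fold_map o_def)
qed (use assms in \<open>simp add: refine_def\<close>)

lemma refine_permute:
  assumes "\<rho> permutes E" and "\<And>u v. r (map \<rho> u) (map \<rho> v) \<longleftrightarrow> r u v"
  shows "refine E N k r (map \<rho> u) (map \<rho> v) \<longleftrightarrow> refine E N k r u v"
proof
  have inv: "map (inv_into UNIV \<rho>) (map \<rho> w) = w" "map \<rho> (map (inv_into UNIV \<rho>) w) = w" for w
    using permutes_inverses[OF assms(1)] by (simp_all add: map_idI)
  have "r (map (inv_into UNIV \<rho>) u) (map (inv_into UNIV \<rho>) v) \<longleftrightarrow> r u v" for u v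
    using assms(2)[of "map (inv_into UNIV \<rho>) u" "map (inv_into UNIV \<rho>) v"] by (simp only: inv)
  then have "refine E N k r (map (inv_into UNIV \<rho>) u) (map (inv_into UNIV \<rho>) v)"
    if "refine E N k r u v" for u v
    using that by (intro refine_permute_imp[where r = r] permutes_inv assms(1))
  then show "refine E N k r u v" if "refine E N k r (map \<rho> u) (map \<rho> v)"
    using that inv by metis
qed (rule refine_permute_imp[where r = r, OF assms])

text \<open>Induction on the rank, with one refinement per step.\<close>

lemma (in involutive_cong) ex_tame_refinement:
  assumes "2 \<le> N"
  shows "\<exists>r'. involutive_cong E r' \<and> tame E N k r' \<and> (\<forall>u v. r' u v \<longrightarrow> r u v) \<and>
    (\<forall>\<rho>. \<rho> permutes E \<longrightarrow> (\<forall>u v. r (map \<rho> u) (map \<rho> v) \<longleftrightarrow> r u v) \<longrightarrow>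
      (\<forall>u v. r' (map \<rho> u) (map \<rho> v) \<longleftrightarrow> r' u v))"
proof (induction k)
  case 0
  show ?case using tame_0 involutive_cong_axioms by blast
next
  case (Suc k)
  then obtain r' where r': "involutive_cong E r'" "tame E N k r'" "\<And>u v. r' u v \<Longrightarrow> r u v"
    "\<And>\<rho> u v. \<rho> permutes E \<Longrightarrow> (\<And>u v. r (map \<rho> u) (map \<rho> v) \<longleftrightarrow> r u v) \<Longrightarrow>
       r' (map \<rho> u) (map \<rho> v) \<longleftrightarrow> r' u v" by blast
  let ?r = "refine E N (Suc k) r'"
  have "involutive_cong E ?r" by (rule involutive_cong.refine_cong[OF r'(1)])
  moreover have "tame E N (Suc k) ?r" by (rule involutive_cong.tame_refine[OF r'(1,2) assms])
  moreover have "r u v" if "?r u v" for u v using that r'(3) by (simp add: refine_def)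
  moreover have "?r (map \<rho> u) (map \<rho> v) \<longleftrightarrow> ?r u v"
    if "\<rho> permutes E" "\<And>u v. r (map \<rho> u) (map \<rho> v) \<longleftrightarrow> r u v" for \<rho> u v
    by (rule refine_permute[OF that(1)]) (rule r'(4)[OF that])
  ultimately show ?case by blast
qed

section \<open>Quotient groups of words\<close>

text \<open>The product ranges over all representatives, which avoids a choice; for a congruence it
  is the class of a concatenation.\<close>

definition quotient_monoid :: "('e list \<Rightarrow> 'e list \<Rightarrow> bool) \<Rightarrow> 'e list set monoid" where
  "quotient_monoid r = \<lparr>carrier = range (\<lambda>u. Collect (r u)),
     monoid.mult = (\<lambda>U V. {w. \<exists>u\<in>U. \<exists>v\<in>V. r (u @ v) w}), one = Collect (r [])\<rparr>"

context involutive_cong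
begin

abbreviation cls :: "'e list \<Rightarrow> 'e list set" where
  "cls u \<equiv> Collect (r u)"

abbreviation Q :: "'e list set monoid" where
  "Q \<equiv> quotient_monoid r"

lemma cls_eq_iff: "cls u = cls v \<longleftrightarrow> r u v"
proof
  assume "cls u = cls v"
  then have "v \<in> cls u" by simp
  then show "r u v" by simp
next
  assume "r u v"
  then show "cls u = cls v" by (auto intro: r_trans r_sym)
qed

lemma carrier_Q: "carrier Q = range cls"
  and one_Q: "\<one>\<^bsub>Q\<^esub> = cls []"
  by (simp_all add: quotient_monoid_def)

lemma mult_Q: "cls u \<otimes>\<^bsub>Q\<^esub> cls v = cls (u @ v)"
proof -
  have "r (u @ v) w" if "r u u'" "r v v'" "r (u' @ v') w" for u' v' w
    using r_append[OF that(1,2)] that(3) r_trans by blast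
  then have "{w. \<exists>u'\<in>cls u. \<exists>v'\<in>cls v. r (u' @ v') w} = cls (u @ v)"
    using r_refl by blast
  then show ?thesis by (simp add: quotient_monoid_def)
qed

lemma group_Q: "group Q"
proof (rule groupI)
  show "\<exists>y\<in>carrier Q. y \<otimes>\<^bsub>Q\<^esub> x = \<one>\<^bsub>Q\<^esub>" if x: "x \<in> carrier Q" for x
  proof -
    obtain u where u: "x = cls u" using x by (auto simp: carrier_Q)
    have "cls (rev u) \<otimes>\<^bsub>Q\<^esub> x = \<one>\<^bsub>Q\<^esub>"
      unfolding u mult_Q one_Q cls_eq_iff by (rule r_rev_append)
    then show ?thesis unfolding carrier_Q by blast
  qed
qed (auto simp: carrier_Q one_Q mult_Q)

text \<open>Each generator is its own inverse, so words in the generators exhaust the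
  subgroup.\<close>

lemma generate_Q: "generate Q ((\<lambda>e. cls [e]) ` A) = cls ` lists A"
proof (intro equalityI subsetI)
  interpret Q: group Q by (rule group_Q)
  fix x assume "x \<in> generate Q ((\<lambda>e. cls [e]) ` A)"
  then show "x \<in> cls ` lists A"
  proof induction
    case one
    then show ?case by (auto simp: one_Q)
  next
    case (incl h)
    then show ?case by auto
  next
    case (inv h)
    then obtain e where e: "e \<in> A" "h = cls [e]" by blast
    have "cls [e] \<otimes>\<^bsub>Q\<^esub> cls [e] = \<one>\<^bsub>Q\<^esub>"
      using r_square by (simp add: mult_Q one_Q cls_eq_iff)
    then have "inv\<^bsub>Q\<^esub> (cls [e]) = cls [e]"
      by (rule Q.inv_equality) (simp_all add: carrier_Q)
    then show ?case using e by auto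
  next
    case (eng h1 h2)
    then obtain a b where "a \<in> lists A" "b \<in> lists A" "h1 = cls a" "h2 = cls b" by blast
    then show ?case by (auto simp: mult_Q intro!: imageI)
  qed
next
  fix x assume "x \<in> cls ` lists A"
  then obtain a where a: "a \<in> lists A" "x = cls a" by blast
  have "cls a \<in> generate Q ((\<lambda>e. cls [e]) ` A)" using a(1)
  proof induction
    case Nil
    show ?case using generate.one[of Q] by (simp add: one_Q)
  next
    case (Cons e u)
    have "cls [e] \<in> generate Q ((\<lambda>e. cls [e]) ` A)"
      by (rule generate.incl) (use Cons in blast)
    then have "cls [e] \<otimes>\<^bsub>Q\<^esub> cls u \<in> generate Q ((\<lambda>e. cls [e]) ` A)"
      using Cons by (intro generate.eng)
    then show ?case by (simp add: mult_Q)
  qed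
  then show "x \<in> generate Q ((\<lambda>e. cls [e]) ` A)" using a(2) by simp
qed

lemma coset_Q: "cls g <#\<^bsub>Q\<^esub> sub_gen Q (\<lambda>e. cls [e]) A = (\<lambda>a. cls (g @ a)) ` lists A"
  by (auto simp: sub_gen_def generate_Q l_coset_def mult_Q)

text \<open>Rank \<open>card E\<close> covers all label sets. Separation at inner indices feeds the
  unrolling; the remaining case \<open>n = 2\<close> contradicts separation at index 0.\<close>

lemma N_acyclic_Q:
  assumes "tame E N (card E) r"
  shows "N_acyclic Q E (\<lambda>e. cls [e]) N"
  unfolding N_acyclic_def
proof (intro notI, elim exE conjE)
  fix n h \<alpha> assume nN: "n \<le> N" and "coset_cycle Q E (\<lambda>e. cls [e]) n h \<alpha>"
  then have n: "2 \<le> n" and h: "\<And>i. i < n \<Longrightarrow> h i \<in> range cls" and \<alpha>: "\<And>i. i < n \<Longrightarrow> \<alpha> i \<subseteq> E"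
    and conn: "\<And>i. i < n \<Longrightarrow> h ((i + 1) mod n) \<in> h i <#\<^bsub>Q\<^esub> sub_gen Q (\<lambda>e. cls [e]) (\<alpha> i)"
    and sep: "\<And>i. i < n \<Longrightarrow>
      (h i <#\<^bsub>Q\<^esub> sub_gen Q (\<lambda>e. cls [e]) (\<alpha> i \<inter> \<alpha> ((i + n - 1) mod n)))
       \<inter> (h ((i + 1) mod n) <#\<^bsub>Q\<^esub> sub_gen Q (\<lambda>e. cls [e]) (\<alpha> i \<inter> \<alpha> ((i + 1) mod n))) = {}"
    unfolding coset_cycle_def carrier_Q by blast+
  define f where "f i = (SOME u. h i = cls u)" for i
  have f: "h i = cls (f i)" if "i < n" for i
    unfolding f_def by (rule someI_ex) (use h[OF that] in blast)
  \<comment> \<open>Reducing the index makes \<open>g n\<close> and \<open>g 0\<close> the same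
    word, which closes the walk.\<close>
  define g where "g i = f (i mod n)" for i
  have hg: "h (i mod n) = cls (g i)" for i using f n by (simp add: g_def)
  have hg': "h i = cls (g i)" if "i < n" for i using hg[of i] that by simp
  have "\<exists>w\<in>lists (\<alpha> i). r (g (Suc i)) (g i @ w)" if "i < n" for i
  proof -
    have "cls (g (i + 1)) \<in> (\<lambda>a. cls (g i @ a)) ` lists (\<alpha> i)"
      using conn[OF that] unfolding hg hg'[OF that] coset_Q .
    then obtain w where "w \<in> lists (\<alpha> i)" "cls (g (i + 1)) = cls (g i @ w)" by blast
    then show ?thesis by (auto simp only: cls_eq_iff Suc_eq_plus1)
  qed
  then obtain w where w: "\<And>i. i < n \<Longrightarrow> w i \<in> lists (\<alpha> i)"
    "\<And>i. i < n \<Longrightarrow> r (g (Suc i)) (g i @ w i)" by metis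
  have sep': "\<not> r (g i @ a) (g (Suc i) @ b)"
    if i: "i < n" and a: "a \<in> lists (\<alpha> i \<inter> \<alpha> ((i + n - 1) mod n))"
      and b: "b \<in> lists (\<alpha> i \<inter> \<alpha> ((i + 1) mod n))" for i a b
  proof
    assume "r (g i @ a) (g (Suc i) @ b)"
    then have "cls (g i @ a) = cls (g (Suc i) @ b)" by (simp only: cls_eq_iff)
    then show False
      using sep[OF i] a b hg[of "i + 1"] unfolding hg'[OF i] by (auto simp only: coset_Q Suc_eq_plus1)
  qed
  have "n = 2 \<and> (\<exists>d\<in>lists (\<alpha> 0 \<inter> \<alpha> 1). r (g 0) (g 1 @ d))"
  proof (rule tame_no_coset_chain[OF assms n nN, where w = w])
    show "card (\<alpha> i) \<le> card E" if "i < n" for i using \<alpha>[OF that] finite_E card_mono by blast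
    show "\<not> r (g (Suc i) @ a) (g (Suc (Suc i)) @ b)"
      if "Suc (Suc i) < n" "a \<in> lists (\<alpha> i \<inter> \<alpha> (Suc i))"
        "b \<in> lists (\<alpha> (Suc i) \<inter> \<alpha> (Suc (Suc i)))" for i a b
      using sep'[of "Suc i" a b] that by (simp add: Int_commute)
  qed (use \<alpha> w in \<open>simp_all add: g_def\<close>)
  then obtain d where "n = 2" "d \<in> lists (\<alpha> 0 \<inter> \<alpha> 1)" "r (g 0) (g 1 @ d)" by blast
  then show False using sep'[of 0 "[]" d] by simp
qed

lemma E_symmetry_Q:
  assumes \<rho>: "\<rho> permutes E" and r: "\<And>u v. r (map \<rho> u) (map \<rho> v) \<longleftrightarrow> r u v"
  shows "E_symmetry Q E (\<lambda>e. cls [e]) \<rho>"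
proof -
  define \<phi> where "\<phi> U = {v. \<exists>u\<in>U. r (map \<rho> u) v}" for U
  have \<phi>: "\<phi> (cls u) = cls (map \<rho> u)" for u
  proof -
    have "r (map \<rho> u) v" if "r u u'" "r (map \<rho> u') v" for u' v
      using that r r_trans by blast
    then show ?thesis unfolding \<phi>_def using r_refl by blast
  qed
  have "\<phi> \<in> hom Q Q" by (rule homI) (auto simp: carrier_Q \<phi> mult_Q)
  moreover have "bij_betw \<phi> (carrier Q) (carrier Q)"
    unfolding bij_betw_def
  proof
    show "inj_on \<phi> (carrier Q)"
      unfolding carrier_Q
    proof (rule inj_onI, elim rangeE)
      fix x y u v assume "\<phi> x = \<phi> y" "x = cls u" "y = cls v"
      then show "x = y" by (simp only: \<phi> cls_eq_iff r)
    qed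
    have "cls u \<in> \<phi> ` range cls" for u
    proof -
      have "map \<rho> (map (inv_into UNIV \<rho>) u) = u"
        using permutes_inverses[OF \<rho>] by (simp add: map_idI)
      then have "cls u = \<phi> (cls (map (inv_into UNIV \<rho>) u))" by (simp only: \<phi>)
      then show ?thesis by blast
    qed
    then show "\<phi> ` carrier Q = carrier Q" by (auto simp: carrier_Q \<phi>)
  qed
  ultimately have "\<phi> \<in> iso Q Q" by (simp add: iso_def)
  moreover have "\<phi> (cls [e]) = cls [\<rho> e]" for e using \<phi>[of "[e]"] by simp
  ultimately show ?thesis unfolding E_symmetry_def by blast
qed

lemma E_group_Q:
  assumes "\<And>e. e \<in> E \<Longrightarrow> \<not> r [e] []" and "\<And>e f. e \<in> E \<Longrightarrow> f \<in> E \<Longrightarrow> r [e] [f] \<Longrightarrow> e = f"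
  shows "E_group Q E (\<lambda>e. cls [e])"
  unfolding E_group_def
proof (intro conjI ballI)
  show "inj_on (\<lambda>e. cls [e]) E" using assms(2) by (auto simp only: inj_on_def cls_eq_iff)
  show "cls [e] \<noteq> \<one>\<^bsub>Q\<^esub>" if "e \<in> E" for e using assms(1)[OF that] by (simp only: one_Q cls_eq_iff simp_thms)
  show "cls [e] \<otimes>\<^bsub>Q\<^esub> cls [e] = \<one>\<^bsub>Q\<^esub>" for e using r_square by (simp add: mult_Q one_Q cls_eq_iff)
  have "cls u \<in> cls ` lists E" for u
    by (rule image_eqI[of _ _ "filter (\<lambda>e. e \<in> E) u"], unfold cls_eq_iff) (rule r_filter, auto)
  then show "generate Q ((\<lambda>e. cls [e]) ` E) = carrier Q" by (auto simp: generate_Q carrier_Q)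
qed (auto simp: group_Q carrier_Q)

end

section \<open>The congruence of an \<open>E\<close>-group\<close>

theorem mainTheorem1:
  fixes E :: "'e set" and G :: "('g, 'b) monoid_scheme" and \<iota> :: "'e \<Rightarrow> 'g" and N :: nat
  assumes "finite E"
    and "E_group G E \<iota>"
    and "finite (carrier G)"
    and "2 \<le> N"
  shows "\<exists>(H :: 'e list set monoid) (\<iota>H :: 'e \<Rightarrow> 'e list set).
           E_group H E \<iota>H \<and> finite (carrier H) \<and> E_dominates H \<iota>H G \<iota> E \<and> N_acyclic H E \<iota>H N \<and>
           (\<forall>\<rho>. \<rho> permutes E \<longrightarrow> E_symmetry G E \<iota> \<rho> \<longrightarrow> E_symmetry H E \<iota>H \<rho>)"
proof -
  interpret G: group G using assms(2) by (simp add: E_group_def)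
  have \<iota>: "\<And>e. e \<in> E \<Longrightarrow> \<iota> e \<in> carrier G" "inj_on \<iota> E" "\<And>e. e \<in> E \<Longrightarrow> \<iota> e \<noteq> \<one>\<^bsub>G\<^esub>"
    "\<And>e. e \<in> E \<Longrightarrow> \<iota> e \<otimes>\<^bsub>G\<^esub> \<iota> e = \<one>\<^bsub>G\<^esub>"
    using assms(2) by (auto simp: E_group_def)
  \<comment> \<open>Letters outside \<open>E\<close> evaluate to the identity, as
    \<open>r_outside\<close> demands.\<close>
  define ev where "ev u = foldr (\<lambda>e x. (if e \<in> E then \<iota> e else \<one>\<^bsub>G\<^esub>) \<otimes>\<^bsub>G\<^esub> x) u \<one>\<^bsub>G\<^esub>" for u
  have ev_simps: "ev [] = \<one>\<^bsub>G\<^esub>" "ev (e # u) = (if e \<in> E then \<iota> e else \<one>\<^bsub>G\<^esub>) \<otimes>\<^bsub>G\<^esub> ev u" for e u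
    by (simp_all add: ev_def)
  have ev_in: "ev u \<in> carrier G" for u by (induction u) (auto simp: ev_simps \<iota>)
  have ev_append: "ev (u @ v) = ev u \<otimes>\<^bsub>G\<^esub> ev v" for u v
    by (induction u) (auto simp: ev_simps \<iota> ev_in G.m_assoc)
  have ev_single: "ev [e] = \<iota> e" if "e \<in> E" for e using that \<iota> by (simp add: ev_simps)
  have ev: "involutive_cong E (\<lambda>u v. ev u = ev v)"
  proof
    have "range (\<lambda>u. {v. ev u = ev v}) \<subseteq> (\<lambda>x. {v. x = ev v}) ` carrier G" using ev_in by auto
    then show "finite (range (\<lambda>u. {v. ev u = ev v}))" using assms(3) finite_surj by blast
  qed (use assms(1) \<iota> in \<open>auto simp: ev_append ev_simps\<close>)
  obtain r where r: "involutive_cong E r" "tame E N (card E) r" "\<forall>u v. r u v \<longrightarrow> ev u = ev v"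
    and perm: "\<forall>\<rho>. \<rho> permutes E \<longrightarrow> (\<forall>u v. ev (map \<rho> u) = ev (map \<rho> v) \<longleftrightarrow> ev u = ev v) \<longrightarrow>
      (\<forall>u v. r (map \<rho> u) (map \<rho> v) \<longleftrightarrow> r u v)"
    using involutive_cong.ex_tame_refinement[OF ev assms(4), of "card E"] by (elim exE conjE) (rule that)
  interpret r: involutive_cong E r by (rule r(1))
  have "E_group r.Q E (\<lambda>e. r.cls [e])"
  proof (rule r.E_group_Q)
    show "\<not> r [e] []" if "e \<in> E" for e
      using r(3) ev_single[OF that] ev_simps(1) \<iota>(3)[OF that] by metis
    show "e = f" if "e \<in> E" "f \<in> E" "r [e] [f]" for e f
      using r(3) that ev_single \<iota>(2) by (metis inj_onD)
  qed
  moreover have "finite (carrier r.Q)" using r.finite_index by (simp add: r.carrier_Q)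
  moreover have "E_dominates r.Q (\<lambda>e. r.cls [e]) G \<iota> E"
  proof -
    \<comment> \<open>The choice does not affect the value, since \<open>r\<close> refines equality
      under \<open>ev\<close>.\<close>
    define h where "h U = ev (SOME u. u \<in> U)" for U
    have h: "h (r.cls u) = ev u" for u
    proof -
      have "(SOME v. v \<in> r.cls u) \<in> r.cls u" by (rule someI[of _ u]) simp
      then have "r u (SOME v. v \<in> r.cls u)" by (rule CollectD)
      with r(3) have "ev u = ev (SOME v. v \<in> r.cls u)" by (elim allE impE)
      then show ?thesis unfolding h_def by (rule sym)
    qed
    have "h \<in> hom r.Q G"
      by (rule homI) (auto simp only: r.carrier_Q h r.mult_Q ev_append ev_in)
    moreover have "h (r.cls [e]) = \<iota> e" if "e \<in> E" for e
      unfolding h by (rule ev_single[OF that])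
    ultimately show ?thesis unfolding E_dominates_def by blast
  qed
  moreover have "N_acyclic r.Q E (\<lambda>e. r.cls [e]) N" by (rule r.N_acyclic_Q[OF r(2)])
  moreover have "E_symmetry r.Q E (\<lambda>e. r.cls [e]) \<rho>"
    if \<rho>: "\<rho> permutes E" and sym: "E_symmetry G E \<iota> \<rho>" for \<rho>
  proof -
    obtain \<phi> where \<phi>: "\<phi> \<in> iso G G" "\<And>e. e \<in> E \<Longrightarrow> \<phi> (\<iota> e) = \<iota> (\<rho> e)"
      using sym unfolding E_symmetry_def by blast
    have hom: "\<phi> \<in> hom G G" and inj: "inj_on \<phi> (carrier G)"
      using \<phi>(1) by (auto simp: iso_def bij_betw_def)
    \<comment> \<open>Injectivity of \<open>\<phi>\<close> then makes equality under
      \<open>ev\<close> invariant under \<open>\<rho>\<close>, and the refinement keeps this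
      invariance.\<close>
    have "ev (map \<rho> u) = \<phi> (ev u)" for u
    proof (induction u)
      case Nil
      then show ?case using hom_one[OF hom G.is_group G.is_group] by (simp add: ev_simps)
    next
      case (Cons e u)
      then show ?case
        using permutes_in_image[OF \<rho>] \<iota>(1) \<phi>(2) hom_mult[OF hom _ ev_in]
        by (auto simp: ev_simps ev_in hom_one[OF hom G.is_group G.is_group])
    qed
    then have "ev (map \<rho> u) = ev (map \<rho> v) \<longleftrightarrow> ev u = ev v" for u v
      using inj ev_in by (auto dest: inj_onD)
    then have "r (map \<rho> u) (map \<rho> v) \<longleftrightarrow> r u v" for u v using perm \<rho> by simp
    then show ?thesis by (rule r.E_symmetry_Q[OF \<rho>])
  qed
  ultimately show ?thesis by blast
qed

end
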